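(* Let $G$ be a finite simple graph that is $(P_3\cup P_2,K_4)$-free. If $G$ contains an induced subgraph isomorphic to the co-domino or to the co-A, then $\chi(G)\le 7$.
   Context: $P_n$ is the path on $n$ vertices, $K_4$ the complete graph on $4$ vertices, $\cup$ disjoint union; "free"/"contains" refer to induced subgraphs; $\chi$ is the chromatic number. Let $C=u_1v_1v_2v_3u_3u_2$ be a $6$-cycle (edges $u_1v_1, v_1v_2, v_2v_3, v_3u_3, u_3u_2, u_2u_1$). The co-domino is the graph obtained from $C$ by adding the edges $v_1v_3$ and $u_1u_3$. The co-A is the graph obtained from $C$ by adding the edges $v_1v_3$, $u_1u_3$ and $u_1v_3$. *)

theory Defs
  imports Main
begin

definition simple_graph :: "'a set \<Rightarrow> ('a \<Rightarrow> 'a \<Rightarrow> bool) \<Rightarrow> bool" where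
  "simple_graph V E \<longleftrightarrow> finite V \<and> (\<forall>x y. E x y \<longrightarrow> E y x) \<and> (\<forall>x. \<not> E x x)
     \<and> (\<forall>x y. E x y \<longrightarrow> x \<in> V \<and> y \<in> V)"

definition contains_induced ::
  "'a set \<Rightarrow> ('a \<Rightarrow> 'a \<Rightarrow> bool) \<Rightarrow> 'b set \<Rightarrow> ('b \<Rightarrow> 'b \<Rightarrow> bool) \<Rightarrow> bool" where
  "contains_induced V E W F \<longleftrightarrow>
     (\<exists>f. inj_on f W \<and> f ` W \<subseteq> V \<and> (\<forall>x\<in>W. \<forall>y\<in>W. E (f x) (f y) \<longleftrightarrow> F x y))"

definition free_of ::
  "'a set \<Rightarrow> ('a \<Rightarrow> 'a \<Rightarrow> bool) \<Rightarrow> 'b set \<Rightarrow> ('b \<Rightarrow> 'b \<Rightarrow> bool) \<Rightarrow> bool" where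
  "free_of V E W F \<longleftrightarrow> \<not> contains_induced V E W F"

definition edges_of :: "(nat \<times> nat) list \<Rightarrow> nat \<Rightarrow> nat \<Rightarrow> bool" where
  "edges_of L x y \<longleftrightarrow> (x, y) \<in> set L \<or> (y, x) \<in> set L"

definition P3_P2_V :: "nat set" where "P3_P2_V = {0..<5}"
definition P3_P2_E :: "nat \<Rightarrow> nat \<Rightarrow> bool" where
  "P3_P2_E = edges_of [(0,1),(1,2),(3,4)]"

definition K4_V :: "nat set" where "K4_V = {0..<4}"
definition K4_E :: "nat \<Rightarrow> nat \<Rightarrow> bool" where
  "K4_E x y \<longleftrightarrow> x \<noteq> y"

text \<open>6-cycle C = u1 v1 v2 v3 u3 u2 with labels u1=0, v1=1, v2=2, v3=3, u3=4, u2=5.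
Co-domino: C plus v1v3 and u1u3. Co-A: additionally u1v3.\<close>
definition hex_V :: "nat set" where "hex_V = {0..<6}"
definition codomino_E :: "nat \<Rightarrow> nat \<Rightarrow> bool" where
  "codomino_E = edges_of [(0,1),(1,2),(2,3),(3,4),(4,5),(5,0),(1,3),(0,4)]"
definition coA_E :: "nat \<Rightarrow> nat \<Rightarrow> bool" where
  "coA_E = edges_of [(0,1),(1,2),(2,3),(3,4),(4,5),(5,0),(1,3),(0,4),(0,3)]"

definition colourable :: "'a set \<Rightarrow> ('a \<Rightarrow> 'a \<Rightarrow> bool) \<Rightarrow> nat \<Rightarrow> bool" where
  "colourable V E k \<longleftrightarrow> (\<exists>c :: 'a \<Rightarrow> nat. (\<forall>v\<in>V. c v < k) \<and>
      (\<forall>x\<in>V. \<forall>y\<in>V. E x y \<longrightarrow> c x \<noteq> c y))"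

definition chromatic_number :: "'a set \<Rightarrow> ('a \<Rightarrow> 'a \<Rightarrow> bool) \<Rightarrow> nat" where
  "chromatic_number V E = (LEAST k. colourable V E k)"

end

theory Submission
  imports Defs
begin

text \<open>
  Let $H$ be an induced co-A or co-domino and sort the other vertices by their neighbourhood in $H$.
  Since $G$ is $(P_3\cup P_2,K_4)$-free, few neighbourhoods occur and many pairs of them span no edge.
  A partition of the occurring neighbourhoods into pairwise edgeless groups is a colouring; for $H$
  alone, seven groups do not suffice. If a vertex with a prescribed neighbourhood exists, or an edge
  with prescribed neighbourhoods of its ends, then adding it to $H$ refines the sorting, and for
  suitable choices seven groups suffice. In a graph that is not 7-colourable such vertices and edges
  are therefore absent, also for the images under automorphisms of $H$, and after a few such
  exclusions seven groups suffice for $H$ itself. Doing this first for the co-A allows the co-domino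
  case to assume that $G$ is co-A-free.
\<close>

section \<open>Templates and certificates\<close>

type_synonym mask = "bool list"

text \<open>A template lists, for each vertex of a fixed small graph, its neighbours and its non-neighbours
  other than itself. Keeping both means that two selected vertices are automatically distinct.\<close>

type_synonym template = "(mask \<times> mask) list"

section \<open>Templates of small graphs and tests for forbidden subgraphs\<close>

definition mask_of :: "nat \<Rightarrow> nat list \<Rightarrow> mask" where
  "mask_of n ps = map (\<lambda>i. i \<in> set ps) [0..<n]"

definition meet :: "mask \<Rightarrow> mask \<Rightarrow> mask" where
  "meet m m' = map2 (\<and>) m m'"

definition select :: "mask \<Rightarrow> 'b list \<Rightarrow> 'b list" where
  "select m xs = map snd (filter fst (zip m xs))"

definition template :: "nat \<Rightarrow> (nat \<Rightarrow> nat \<Rightarrow> bool) \<Rightarrow> template" where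
  "template n F = map (\<lambda>i. (map (F i) [0..<n], map (\<lambda>j. j \<noteq> i \<and> \<not> F i j) [0..<n])) [0..<n]"

text \<open>The closing \<open>False\<close> in both lists of the new row keeps a vertex out of its
  own neighbours and non-neighbours.\<close>

definition add_vertex :: "mask \<Rightarrow> template \<Rightarrow> template" where
  "add_vertex t g = map2 (\<lambda>b (N, M). (N @ [b], M @ [\<not> b])) t g @ [(t @ [False], map Not t @ [False])]"

definition sub_template :: "nat list \<Rightarrow> template \<Rightarrow> template" where
  "sub_template ps g = map (\<lambda>i. (map (\<lambda>j. fst (g ! i) ! j) ps, map (\<lambda>j. snd (g ! i) ! j) ps)) ps"

definition edge_in :: "template \<Rightarrow> mask \<Rightarrow> bool" where
  "edge_in g m \<longleftrightarrow> (\<exists>(N, M) \<in> set (select m g). True \<in> set (meet m N))"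

definition non_edge_in :: "template \<Rightarrow> mask \<Rightarrow> bool" where
  "non_edge_in g m \<longleftrightarrow> (\<exists>(N, M) \<in> set (select m g). True \<in> set (meet m M))"

definition triangle_in :: "template \<Rightarrow> mask \<Rightarrow> bool" where
  "triangle_in g m \<longleftrightarrow> (\<exists>(N, M) \<in> set (select m g). edge_in g (meet m N))"

definition P3_in :: "template \<Rightarrow> mask \<Rightarrow> bool" where
  "P3_in g m \<longleftrightarrow> (\<exists>(N, M) \<in> set (select m g). non_edge_in g (meet m N))"

text \<open>The neighbourhood \<^term>\<open>t\<close> of a further vertex is impossible if that vertex lies in an induced
  $K_4$ or $P_3\cup P_2$; the last three disjuncts put it on the $P_2$, in the middle of the $P_3$
  and at an end of the $P_3$.\<close>

definition impossible :: "template \<Rightarrow> mask \<Rightarrow> bool" where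
  "impossible g t \<longleftrightarrow> triangle_in g t \<or>
    (\<exists>(N, M) \<in> set (select t g). P3_in g (meet (map Not t) M) \<or>
      (\<exists>(N', M') \<in> set (select (meet t M) g). edge_in g (meet (map Not t) (meet M M'))) \<or>
      (\<exists>(N', M') \<in> set (select (meet (map Not t) N) g). edge_in g (meet (map Not t) (meet M M'))))"

text \<open>If \<open>x\<close> and \<open>y\<close> outside the template were adjacent with
  neighbourhoods \<open>t\<close> and \<open>u\<close>, the disjuncts would give in turn: a K4 on
  \<open>x\<close>, \<open>y\<close> and two adjacent common neighbours; the edge \<open>x y\<close>
  beside a P3 of common non-neighbours; a path a-x-y or a-y-x beside an edge of common
  non-neighbours that a misses.\<close>

definition anticomplete :: "template \<Rightarrow> mask \<Rightarrow> mask \<Rightarrow> bool" where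
  "anticomplete g t u \<longleftrightarrow> edge_in g (meet t u) \<or> P3_in g (meet (map Not t) (map Not u)) \<or>
    (\<exists>(N, M) \<in> set (select (meet t (map Not u)) g). edge_in g (meet (meet (map Not t) (map Not u)) M)) \<or>
    (\<exists>(N, M) \<in> set (select (meet u (map Not t)) g). edge_in g (meet (meet (map Not t) (map Not u)) M))"

definition matching :: "template \<Rightarrow> mask \<Rightarrow> bool" where
  "matching g t \<longleftrightarrow> True \<in> set t \<and> edge_in g (map Not t)"

section \<open>Colour classes, exclusion steps and their checker\<close>

text \<open>A colour class consists of template vertices and of neighbourhoods of further vertices. Template
  vertices 0 to 5 always form the co-domino or co-A, so \<^term>\<open>take 6\<close> restricts a neighbourhood to it;
  \<open>T\<close> and \<open>X\<close> record the possible neighbourhoods in these six vertices and the pairs of them already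
  known not to occur at the two ends of an edge.\<close>

type_synonym classes = "(nat list \<times> nat list list) list"

definition apart :: "template \<Rightarrow> (mask \<times> mask) list \<Rightarrow> mask \<Rightarrow> mask \<Rightarrow> bool" where
  "apart g X t u \<longleftrightarrow> (take 6 t, take 6 u) \<in> set X \<or> (take 6 u, take 6 t) \<in> set X \<or> anticomplete g t u"

text \<open>A neighbourhood listed in two classes belongs to vertices that induce a matching; its two colours
  are given to the two ends of each edge.\<close>

definition stable_class :: "template \<Rightarrow> (mask \<times> mask) list \<Rightarrow> mask list list \<Rightarrow> mask \<Rightarrow> mask list \<Rightarrow> bool" where
  "stable_class g X tss b ts \<longleftrightarrow> \<not> edge_in g b \<and> sorted_wrt (apart g X) ts \<and>
    (\<forall>t \<in> set ts. True \<notin> set (meet t b) \<and>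
      (apart g X t t \<or> matching g t \<and> 2 \<le> length (filter (\<lambda>ts'. t \<in> set ts') tss)))"

text \<open>The masks \<open>s @ p\<close> run through all extensions of a neighbourhood in the
  first six vertices by adjacencies to the remaining template vertices.\<close>

definition coloured :: "template \<Rightarrow> mask list \<Rightarrow> (mask \<times> mask) list \<Rightarrow> mask list \<Rightarrow> mask list list \<Rightarrow> bool" where
  "coloured g T X bs tss \<longleftrightarrow> length tss = 7 \<and> length bs = 7 \<and>
    (\<forall>i \<in> set [0..<length g]. \<exists>b \<in> set bs. b ! i) \<and>
    (\<forall>s \<in> set T. \<forall>p \<in> set (List.n_lists (length g - 6) [False, True]).
      impossible g (s @ p) \<or> (\<exists>ts \<in> set tss. s @ p \<in> set ts)) \<and>
    list_all2 (stable_class g X tss) bs tss"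

datatype reason = Colouring classes | Occurrence "nat list"

text \<open>A step excludes a vertex 6 with the given neighbours, respectively an edge between vertices 6 and 7
  with the given neighbours, because the enlarged template is 7-colourable or contains a template
  that was excluded before.\<close>

datatype step = No_vertex "nat list" reason | No_edge "nat list" "nat list" reason

fun refuted :: "template list \<Rightarrow> mask list \<Rightarrow> (mask \<times> mask) list \<Rightarrow> template \<Rightarrow> reason \<Rightarrow> bool" where
  "refuted Q T X g (Colouring cs) =
     coloured g T X (map (\<lambda>c. mask_of (length g) (fst c)) cs) (map (\<lambda>c. map (mask_of (length g)) (snd c)) cs)"
| "refuted Q T X g (Occurrence ps) =
     (distinct ps \<and> (\<forall>i \<in> set ps. i < length g) \<and> sub_template ps g \<in> set Q)"

definition permute :: "mask \<Rightarrow> nat list \<Rightarrow> mask" where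
  "permute t p = map (\<lambda>i. t ! i) p"

text \<open>Exclusions spread to images under \<open>A\<close>. For edges the images are computed
  forwards, so the involution test is what leads from an image back to the refuted pair. The final
  \<open>True\<close> joins vertex 7 to vertex 6.\<close>

fun verify :: "template list \<Rightarrow> nat list list \<Rightarrow> template \<Rightarrow> mask list \<Rightarrow> (mask \<times> mask) list \<Rightarrow>
    step list \<Rightarrow> reason \<Rightarrow> bool" where
  "verify Q A g T X [] r = refuted Q T X g r"
| "verify Q A g T X (No_vertex s r' # ss) r =
    (refuted Q T X (add_vertex (mask_of 6 s) g) r' \<and>
     verify Q A g (filter (\<lambda>t. \<forall>p \<in> set A. permute t p \<noteq> mask_of 6 s) T) X ss r)"
| "verify Q A g T X (No_edge s u r' # ss) r =
    (refuted Q T X (add_vertex (mask_of 6 u @ [True]) (add_vertex (mask_of 6 s) g)) r' \<and>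
     (\<forall>p \<in> set A. permute (permute (mask_of 6 s) p) p = mask_of 6 s \<and> permute (permute (mask_of 6 u) p) p = mask_of 6 u) \<and>
     verify Q A g T (map (\<lambda>p. (permute (mask_of 6 s) p, permute (mask_of 6 u) p)) A @ X) ss r)"

definition automorphism :: "template \<Rightarrow> nat list \<Rightarrow> bool" where
  "automorphism g p \<longleftrightarrow> distinct p \<and> length p = length g \<and> (\<forall>i \<in> set p. i < length g) \<and> sub_template p g = g"

definition verified :: "template list \<Rightarrow> nat list list \<Rightarrow> template \<Rightarrow> step list \<Rightarrow> reason \<Rightarrow> bool" where
  "verified Q A g ss r \<longleftrightarrow> length g = 6 \<and> list_all (automorphism g) A \<and>
     verify Q A g (filter (\<lambda>t. \<not> impossible g t) (List.n_lists 6 [False, True])) [] ss r"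

section \<open>Soundness of the certificates\<close>

lemma select_map [simp]: "select (map p vs) (map f vs) = map f (filter p vs)"
  by (induction vs) (auto simp: select_def)

lemma meet_map [simp]: "meet (map p vs) (map q vs) = map (\<lambda>v. p v \<and> q v) vs"
  by (induction vs) (auto simp: meet_def)

text \<open>Both ends of an edge define the same pair, hence the same chosen representative; the
  orientation marks the end that was chosen.\<close>

lemma ex_matching_orientation:
  assumes sym: "\<And>x y. R x y \<Longrightarrow> R y x" and irrefl: "\<And>x. \<not> R x x"
    and unique: "\<And>x y z. R x y \<Longrightarrow> R x z \<Longrightarrow> y = z"
  shows "\<exists>h :: 'a \<Rightarrow> bool. \<forall>x y. R x y \<longrightarrow> h x \<noteq> h y"
proof (intro exI allI impI)
  define rep where "rep x = (SOME z. z = x \<or> R x z)" for x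
  fix x y assume R: "R x y"
  have "(\<lambda>z. z = x \<or> R x z) = (\<lambda>z. z = y \<or> R y z)"
    using R sym unique by blast
  then have "rep x = rep y" by (simp add: rep_def)
  moreover have "rep x = x \<or> R x (rep x)"
    unfolding rep_def by (rule someI[of "\<lambda>z. z = x \<or> R x z" x]) simp
  then have "rep x = x \<or> rep x = y" using R unique by blast
  moreover have "x \<noteq> y" using R irrefl by blast
  ultimately show "(rep x = x) \<noteq> (rep y = y)" by auto
qed

locale P3_P2_K4_free =
  fixes V :: "'a set" and E :: "'a \<Rightarrow> 'a \<Rightarrow> bool"
  assumes simple: "simple_graph V E"
    and P3_P2_free: "free_of V E P3_P2_V P3_P2_E"
    and K4_free: "free_of V E K4_V K4_E"
begin

lemma sym: "E x y \<Longrightarrow> E y x" and irrefl [simp]: "\<not> E x x"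
  and in_V: "E x y \<Longrightarrow> x \<in> V" "E x y \<Longrightarrow> y \<in> V"
  using simple by (auto simp: simple_graph_def)

lemma sym_iff: "E x y \<longleftrightarrow> E y x"
  using sym by blast

lemma no_K4: "E a b \<Longrightarrow> E a c \<Longrightarrow> E a d \<Longrightarrow> E b c \<Longrightarrow> E b d \<Longrightarrow> E c d \<Longrightarrow> False"
proof -
  assume edges: "E a b" "E a c" "E a d" "E b c" "E b d" "E c d"
  have K4_V: "K4_V = {0, 1, 2, 3}" by (auto simp: K4_V_def)
  have dist: "a \<noteq> b" "a \<noteq> c" "a \<noteq> d" "b \<noteq> c" "b \<noteq> d" "c \<noteq> d"
    using edges irrefl by blast+
  have "contains_induced V E K4_V K4_E"
    unfolding contains_induced_def K4_V
    by (rule exI[of _ "\<lambda>i. [a, b, c, d] ! i"])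
      (use edges edges[THEN sym] dist in_V in \<open>auto simp: K4_E_def inj_on_def\<close>)
  then show False using K4_free by (simp add: free_of_def)
qed

lemma no_P3_P2:
  assumes "E a b" "E b c" "E d e" "a \<noteq> c" "\<not> E a c" "\<not> E a d" "\<not> E a e" "\<not> E b d" "\<not> E b e"
    "\<not> E c d" "\<not> E c e"
  shows False
proof -
  have P3_P2_V: "P3_P2_V = {0, 1, 2, 3, 4}" by (auto simp: P3_P2_V_def)
  have dist: "a \<noteq> b" "b \<noteq> c" "d \<noteq> e" "a \<noteq> d" "a \<noteq> e" "b \<noteq> d" "b \<noteq> e" "c \<noteq> d" "c \<noteq> e"
    using assms irrefl sym by blast+
  have rev: "E b a" "E c b" "E e d" "\<not> E c a" "\<not> E d a" "\<not> E e a" "\<not> E d b" "\<not> E e b" "\<not> E d c" "\<not> E e c"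
    using assms sym by blast+
  have "contains_induced V E P3_P2_V P3_P2_E"
    unfolding contains_induced_def P3_P2_V
    by (rule exI[of _ "\<lambda>i. [a, b, c, d, e] ! i"])
      (use assms dist dist[symmetric] rev in_V in \<open>auto simp: P3_P2_E_def edges_of_def inj_on_def\<close>)
  then show False using P3_P2_free by (simp add: free_of_def)
qed

section \<open>Templates realised by vertex lists of the graph\<close>

definition view :: "'a list \<Rightarrow> template" where
  "view vs = map (\<lambda>v. (map (E v) vs, map (\<lambda>w. w \<noteq> v \<and> \<not> E v w) vs)) vs"

definition copy :: "'a list \<Rightarrow> template \<Rightarrow> bool" where
  "copy vs g \<longleftrightarrow> distinct vs \<and> set vs \<subseteq> V \<and> view vs = g"

lemma length_view [simp]: "length (view vs) = length vs"
  by (simp add: view_def)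

text \<open>The arbitrary \<open>P\<close> allows rewriting at every level of the nested template
  tests, which turns them into statements about vertices.\<close>

lemma ex_select_view:
  "(\<exists>(N, M) \<in> set (select (map p vs) (view vs)). P N M) \<longleftrightarrow>
    (\<exists>v \<in> set vs. p v \<and> P (map (E v) vs) (map (\<lambda>w. w \<noteq> v \<and> \<not> E v w) vs))"
  by (auto simp: view_def)

lemma edge_in_view:
  "edge_in (view vs) (map p vs) \<longleftrightarrow> (\<exists>a \<in> set vs. \<exists>b \<in> set vs. p a \<and> p b \<and> E a b)"
  unfolding edge_in_def ex_select_view by auto

lemma non_edge_in_view:
  "non_edge_in (view vs) (map p vs) \<longleftrightarrow> (\<exists>a \<in> set vs. \<exists>b \<in> set vs. p a \<and> p b \<and> b \<noteq> a \<and> \<not> E a b)"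
  unfolding non_edge_in_def ex_select_view by auto

lemma triangle_in_view:
  "triangle_in (view vs) (map p vs) \<longleftrightarrow>
    (\<exists>a \<in> set vs. \<exists>b \<in> set vs. \<exists>c \<in> set vs. p a \<and> p b \<and> p c \<and> E a b \<and> E a c \<and> E b c)"
  unfolding triangle_in_def ex_select_view by (auto simp: edge_in_view)

lemma P3_in_view:
  "P3_in (view vs) (map p vs) \<longleftrightarrow>
    (\<exists>b \<in> set vs. \<exists>a \<in> set vs. \<exists>c \<in> set vs. p a \<and> p b \<and> p c \<and> E b a \<and> E b c \<and> c \<noteq> a \<and> \<not> E a c)"
  unfolding P3_in_def ex_select_view by (auto simp: non_edge_in_view)

lemma map_Not_map: "map Not (map p vs) = map (\<lambda>v. \<not> p v) vs"
  by simp

lemma not_impossible: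
  assumes "x \<notin> set vs"
  shows "\<not> impossible (view vs) (map (E x) vs)"
proof
  assume "impossible (view vs) (map (E x) vs)"
  then show False
    unfolding impossible_def map_Not_map ex_select_view meet_map triangle_in_view P3_in_view edge_in_view
  proof (elim disjE bexE conjE)
    fix a b c assume "E x a" "E x b" "E x c" "E a b" "E a c" "E b c"
    then show False using no_K4 by blast
  next
    fix d b a c
    assume "E x d" "E b a" "E b c" "c \<noteq> a" "\<not> E a c" "\<not> E x a" "\<not> E x b" "\<not> E x c"
      "\<not> E d a" "\<not> E d b" "\<not> E d c"
    then show False using no_P3_P2[of a b c x d] sym by blast
  next
    fix a b c d
    assume "E x a" "E x b" "b \<noteq> a" "\<not> E a b" "\<not> E x c" "\<not> E x d" "\<not> E a c" "\<not> E a d"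
      "\<not> E b c" "\<not> E b d" "E c d"
    then show False using no_P3_P2[of a x b c d] sym by blast
  next
    fix a b c d
    assume "E x a" "\<not> E x b" "b \<in> set vs" "E a b" "\<not> E x c" "\<not> E x d" "\<not> E a c" "\<not> E a d"
      "\<not> E b c" "\<not> E b d" "E c d"
    \<comment> \<open>The path is x-a-b; its ends differ because \<open>b\<close> lies in
      \<open>vs\<close> and \<open>x\<close> does not.\<close>
    then show False using no_P3_P2[of x a b c d] assms by blast
  qed
qed

lemma not_anticomplete:
  assumes "E x y" "x \<notin> set vs" "y \<notin> set vs"
  shows "\<not> anticomplete (view vs) (map (E x) vs) (map (E y) vs)"
proof
  assume "anticomplete (view vs) (map (E x) vs) (map (E y) vs)"
  then show False
    unfolding anticomplete_def map_Not_map ex_select_view meet_map P3_in_view edge_in_view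
  proof (elim disjE bexE conjE)
    fix a b assume "E x a" "E y a" "E x b" "E y b" "E a b"
    then show False using no_K4[of x y a b] assms by blast
  next
    fix b a c
    assume "\<not> E x a" "\<not> E y a" "\<not> E x b" "\<not> E y b" "\<not> E x c" "\<not> E y c"
      "E b a" "E b c" "c \<noteq> a" "\<not> E a c"
    then show False using no_P3_P2[of a b c x y] assms sym by blast
  next
    fix a c d
    assume "a \<in> set vs" "E x a" "\<not> E y a" "\<not> E x c" "\<not> E y c" "\<not> E a c" "\<not> E x d" "\<not> E y d" "\<not> E a d" "E c d"
    then show False using no_P3_P2[of a x y c d] assms sym by blast
  next
    fix a c d
    assume "a \<in> set vs" "E y a" "\<not> E x a" "\<not> E x c" "\<not> E y c" "\<not> E a c" "\<not> E x d" "\<not> E y d" "\<not> E a d" "E c d"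
    then show False using no_P3_P2[of a y x c d] assms sym by blast
  qed
qed

text \<open>If \<open>y\<close> and \<open>z\<close> were distinct, they would form a K4 with
  \<open>x\<close> and a common neighbour when adjacent, and otherwise a P3 centred at
  \<open>x\<close> beside an edge of common non-neighbours.\<close>

lemma matching_unique:
  assumes "matching (view vs) (map (E x) vs)" and "E x y" "E x z"
    and "map (E x) vs = map (E y) vs" "map (E x) vs = map (E z) vs"
  shows "y = z"
proof (rule ccontr)
  assume "y \<noteq> z"
  have same: "E y v = E x v" "E z v = E x v" if "v \<in> set vs" for v
    using assms(4,5) that by (simp_all add: list_eq_iff_nth_eq) (metis in_set_conv_nth)+
  obtain k where "k \<in> set vs" "E x k" using assms(1) by (auto simp: matching_def)
  then have k: "E x k" "E y k" "E z k" using same by auto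
  obtain a b where "a \<in> set vs" "b \<in> set vs" "\<not> E x a" "\<not> E x b" "E a b"
    using assms(1) unfolding matching_def map_Not_map edge_in_view by blast
  then have "E a b" "\<not> E x a" "\<not> E x b" "\<not> E y a" "\<not> E y b" "\<not> E z a" "\<not> E z b"
    using same by auto
  then show False
    using no_K4[of x y z k] no_P3_P2[of y x z a b] assms(2,3) k \<open>y \<noteq> z\<close> sym by blast
qed

lemma copy_snoc:
  assumes "copy vs g" "x \<in> V - set vs" "map (E x) vs = t"
  shows "copy (vs @ [x]) (add_vertex t g)"
proof -
  have "zip (map (E x) vs) (view vs) =
      map (\<lambda>v. (E x v, map (E v) vs, map (\<lambda>w. w \<noteq> v \<and> \<not> E v w) vs)) vs"
    unfolding view_def by (simp add: zip_map_map zip_same_conv_map)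
  then have "view (vs @ [x]) = add_vertex (map (E x) vs) (view vs)"
    using assms(2) sym_iff[of x] by (auto simp: add_vertex_def view_def)
  then show ?thesis using assms by (auto simp: copy_def)
qed

lemma copy_sub_template:
  assumes "copy vs g" "distinct ps" "\<forall>i \<in> set ps. i < length vs"
  shows "copy (map (\<lambda>i. vs ! i) ps) (sub_template ps g)"
proof -
  have "inj_on (\<lambda>i. vs ! i) (set ps)"
    using assms by (auto simp: inj_on_def copy_def nth_eq_iff_index_eq)
  moreover have "view (map (\<lambda>i. vs ! i) ps) = sub_template ps (view vs)"
    using assms(3) by (simp add: view_def sub_template_def)
  ultimately show ?thesis
    using assms by (auto simp: copy_def distinct_map)
qed

text \<open>Relabelling keeps the template and the set of outside vertices and only permutes
  neighbourhoods, so facts about all copies transfer along automorphisms.\<close>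

lemma automorphism_copy:
  assumes "copy vs g" "automorphism g p"
  shows "copy (map (\<lambda>i. vs ! i) p) g" and "set (map (\<lambda>i. vs ! i) p) = set vs"
    and "map (E x) (map (\<lambda>i. vs ! i) p) = permute (map (E x) vs) p"
proof -
  have p: "distinct p" "\<forall>i \<in> set p. i < length vs" "length p = length vs"
    using assms by (auto simp: automorphism_def copy_def)
  show c: "copy (map (\<lambda>i. vs ! i) p) g"
    using copy_sub_template[OF assms(1) p(1,2)] assms(2) by (simp add: automorphism_def)
  have "set (map (\<lambda>i. vs ! i) p) \<subseteq> set vs" using p(2) by auto
  moreover have "card (set (map (\<lambda>i. vs ! i) p)) = card (set vs)"
    using c assms(1) p(3) by (simp only: copy_def distinct_card length_map)
  ultimately show "set (map (\<lambda>i. vs ! i) p) = set vs"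
    by (meson List.finite_set card_subset_eq)
  show "map (E x) (map (\<lambda>i. vs ! i) p) = permute (map (E x) vs) p"
    using p(2) by (simp add: permute_def)
qed

section \<open>From a checked certificate to a 7-colouring\<close>

definition obeys :: "mask list \<Rightarrow> (mask \<times> mask) list \<Rightarrow> 'a list \<Rightarrow> bool" where
  "obeys T X hs \<longleftrightarrow> (\<forall>x \<in> V - set hs. map (E x) hs \<in> set T) \<and>
     (\<forall>x \<in> V - set hs. \<forall>y \<in> V - set hs. E x y \<longrightarrow> (map (E x) hs, map (E y) hs) \<notin> set X)"

text \<open>Every vertex lies in one of seven classes. Adjacent vertices share a class only if they
  have the same matching neighbourhood, listed in at least two classes; the least and the greatest
  of these then separate them.\<close>

lemma colourable_if_coloured:
  assumes copy: "copy vs g" and len: "length vs \<ge> 6" and obeys: "obeys T X (take 6 vs)"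
    and coloured: "coloured g T X bs tss" and len_bs: "\<forall>b \<in> set bs. length b = length vs"
  shows "colourable V E 7"
proof -
  have g: "g = view vs" and vs: "distinct vs" "set vs \<subseteq> V"
    using copy by (auto simp: copy_def)
  have lens: "length tss = 7" "length bs = 7"
    and cover_vs: "\<And>i. i < length vs \<Longrightarrow> \<exists>b \<in> set bs. b ! i"
    and cover_types: "\<And>s p. s \<in> set T \<Longrightarrow> length p = length vs - 6 \<Longrightarrow>
      impossible g (s @ p) \<or> (\<exists>ts \<in> set tss. s @ p \<in> set ts)"
    and stable: "\<And>i. i < 7 \<Longrightarrow> stable_class g X tss (bs ! i) (tss ! i)"
    using coloured g by (auto simp: coloured_def set_n_lists list_all2_conv_all_nth)
  define type where "type x = map (E x) vs" for x
  define member where "member i x \<longleftrightarrow>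
    (if x \<in> set vs then \<exists>j < length vs. vs ! j = x \<and> bs ! i ! j else type x \<in> set (tss ! i))" for i x
  \<comment> \<open>On \<open>vs\<close> each mask is the indicator of its class, the form that the
    rules for \<open>view\<close> expect.\<close>
  have bs: "bs ! i = map (member i) vs" if "i < 7" for i
    using len_bs lens that vs(1) by (intro nth_equalityI) (auto simp: member_def nth_eq_iff_index_eq)
  have take_type: "take 6 (type x) = map (E x) (take 6 vs)" for x
    by (simp add: type_def take_map)
  have outside: "x \<in> V - set (take 6 vs)" if "x \<in> V" "x \<notin> set vs" for x
    using that set_take_subset[of 6 vs] by auto
  have ex_member: "\<exists>i < 7. member i x" if "x \<in> V" for x
  proof (cases "x \<in> set vs")
    case True
    then obtain j where j: "j < length vs" "vs ! j = x" by (auto simp: in_set_conv_nth)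
    then obtain i where "i < 7" "bs ! i ! j" using cover_vs lens by (metis in_set_conv_nth)
    then show ?thesis using True j by (auto simp: member_def)
  next
    case False
    have "take 6 (type x) \<in> set T"
      using obeys outside[OF that False] by (auto simp: obeys_def take_type)
    then have "impossible g (type x) \<or> (\<exists>ts \<in> set tss. type x \<in> set ts)"
      using cover_types[of "take 6 (type x)" "drop 6 (type x)"] by (simp add: type_def)
    then have "\<exists>ts \<in> set tss. type x \<in> set ts"
      using not_impossible[OF False] g by (simp add: type_def)
    then obtain i where "i < 7" "type x \<in> set (tss ! i)" using lens by (metis in_set_conv_nth)
    then show ?thesis using False by (auto simp: member_def)
  qed
  have not_apart: "\<not> apart g X (type x) (type y)" if "E x y" "x \<notin> set vs" "y \<notin> set vs" for x y
  proof -
    have "E y x" "x \<in> V - set (take 6 vs)" "y \<in> V - set (take 6 vs)"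
      using that sym in_V outside by blast+
    then have "(take 6 (type x), take 6 (type y)) \<notin> set X" "(take 6 (type y), take 6 (type x)) \<notin> set X"
      using that(1) obeys unfolding obeys_def take_type by blast+
    then show ?thesis
      using not_anticomplete[OF that] g by (simp add: apart_def type_def)
  qed
  define R where "R x y \<longleftrightarrow> x \<notin> set vs \<and> y \<notin> set vs \<and> E x y \<and> type x = type y \<and> matching g (type x)" for x y
  have R_sym: "R y x" if "R x y" for x y using that sym by (auto simp: R_def)
  have R_irrefl: "\<not> R x x" for x by (simp add: R_def)
  have R_unique: "y = z" if "R x y" "R x z" for x y z
    using that unfolding R_def type_def g by (elim conjE) (rule matching_unique[of vs x])
  have "\<exists>h :: 'a \<Rightarrow> bool. \<forall>x y. R x y \<longrightarrow> h x \<noteq> h y"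
    by (rule ex_matching_orientation) (erule R_sym, rule R_irrefl, erule (1) R_unique)
  then obtain h :: "'a \<Rightarrow> bool" where h: "\<And>x y. R x y \<Longrightarrow> h x \<noteq> h y" by blast
  define I where "I x = {i. i < 7 \<and> member i x}" for x
  have fin: "finite (I x)" for x by (simp add: I_def)
  have conflict: "R x y \<and> I x = I y \<and> 2 \<le> card (I x)"
    if E: "E x y" and i: "i < 7" "member i x" "member i y" for x y i
  proof -
    note st = stable[OF i(1), unfolded stable_class_def bs[OF i(1)] g]
    have mixed: False if "E u v" "u \<notin> set vs" "v \<in> set vs" "member i u" "member i v" for u v
    proof -
      have "type u \<in> set (tss ! i)" using that by (simp add: member_def)
      then have "True \<notin> set (meet (type u) (map (member i) vs))" using st by blast
      then show False using that by (auto simp: type_def)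
    qed
    have "\<not> (x \<in> set vs \<and> y \<in> set vs)"
      using st E i by (auto simp: edge_in_view)
    then have out: "x \<notin> set vs" "y \<notin> set vs" using mixed E i sym by blast+
    have mem: "type x \<in> set (tss ! i)" "type y \<in> set (tss ! i)"
      using i out by (auto simp: member_def)
    \<comment> \<open>Different neighbourhoods in one class are apart in one order or the other,
      which an edge rules out.\<close>
    have eq: "type x = type y"
    proof (rule ccontr)
      assume ne: "type x \<noteq> type y"
      obtain a b where ab: "a < length (tss ! i)" "b < length (tss ! i)" "tss ! i ! a = type x" "tss ! i ! b = type y"
        using mem by (auto simp: in_set_conv_nth)
      have "sorted_wrt (apart g X) (tss ! i)" using st g by blast
      moreover have "a < b \<or> b < a" using ab ne by (metis linorder_neqE_nat)
      ultimately have "apart g X (type x) (type y) \<or> apart g X (type y) (type x)"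
        using ab by (metis sorted_wrt_nth_less)
      then show False using not_apart E out sym by blast
    qed
    have "\<not> apart g X (type x) (type x)" using not_apart[OF E out] eq by simp
    then have M: "matching g (type x)" "2 \<le> length (filter (\<lambda>ts'. type x \<in> set ts') tss)"
      using st mem(1) g by blast+
    have "I x = {i. i < length tss \<and> type x \<in> set (tss ! i)}"
      using out lens by (auto simp: I_def member_def)
    then have "2 \<le> card (I x)" using M(2) by (simp add: length_filter_conv_card)
    moreover have "I x = I y" using out eq by (simp add: I_def member_def)
    ultimately show ?thesis using M out E eq by (simp add: R_def)
  qed
  \<comment> \<open>The orientation \<open>h\<close> gives the two ends of a matching edge the least
    and the greatest of their common classes.\<close>
  define c where "c x = (if h x then Min (I x) else Max (I x))" for x
  have c: "c x \<in> I x" if "x \<in> V" for x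
    using ex_member[OF that] fin by (auto simp: c_def I_def[symmetric] intro!: Min_in Max_in) (auto simp: I_def)
  have "c x \<noteq> c y" if "x \<in> V" "y \<in> V" "E x y" for x y
  proof
    assume same: "c x = c y"
    have "c x < 7" "member (c x) x" "member (c x) y"
      using c[OF that(1)] c[OF that(2)] same by (simp_all add: I_def)
    from conflict[OF that(3) this] have R: "R x y" "I x = I y" "2 \<le> card (I x)" by auto
    then have "Min (I x) = Max (I x)"
      using same h[OF R(1)] by (auto simp: c_def split: if_splits)
    then have "I x \<subseteq> {Min (I x)}"
      using Min_le[OF fin] Max_ge[OF fin] by (metis order_antisym singletonI subsetI)
    then have "card (I x) \<le> 1" using card_mono[of "{Min (I x)}" "I x"] by simp
    then show False using R(3) by simp
  qed
  moreover have "\<forall>x \<in> V. c x < 7" using c by (auto simp: I_def)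
  ultimately show ?thesis unfolding colourable_def by blast
qed

section \<open>Soundness of the exclusion steps\<close>

lemma not_refuted:
  assumes "\<not> colourable V E 7" and "\<And>q vs. q \<in> set Q \<Longrightarrow> \<not> copy vs q"
    and "copy vs g" "length vs \<ge> 6" "obeys T X (take 6 vs)"
  shows "\<not> refuted Q T X g r"
proof (cases r)
  case (Colouring cs)
  have len: "length g = length vs" using assms(3) by (auto simp: copy_def)
  have "\<forall>b \<in> set (map (\<lambda>c. mask_of (length g) (fst c)) cs). length b = length vs"
    by (auto simp: mask_of_def len)
  then show ?thesis
    using assms(1) colourable_if_coloured[OF assms(3-5)] Colouring by (metis refuted.simps(1))
next
  case (Occurrence ps)
  have "length g = length vs" using assms(3) by (auto simp: copy_def)
  then show ?thesis
    using assms(2) copy_sub_template[OF assms(3)] Occurrence by auto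
qed

text \<open>The invariant \<open>obeys T X\<close> is carried for all copies of \<open>g\<close>,
  since each exclusion is also applied to relabelled copies. Once the steps are used up, the final
  reason would refute \<open>g\<close> itself, which has a copy.\<close>

lemma not_verify:
  assumes "\<not> colourable V E 7" and "\<And>q vs. q \<in> set Q \<Longrightarrow> \<not> copy vs q"
    and "\<forall>p \<in> set A. automorphism g p" and "length g = 6"
    and "\<And>hs. copy hs g \<Longrightarrow> obeys T X hs" and "copy hs g"
  shows "\<not> verify Q A g T X ss r"
  using assms(5)
proof (induction ss arbitrary: T X)
  case Nil
  have "length hs = 6" using assms(4,6) by (auto simp: copy_def)
  then show ?case using not_refuted[OF assms(1,2,6)] Nil[OF assms(6)] by simp
next
  case (Cons s ss)
  have len: "length hs = 6" if "copy hs g" for hs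
    using that assms(4) by (auto simp: copy_def)
  show ?case
  proof (cases s)
    case (No_vertex s0 r')
    show ?thesis
    proof
      assume "verify Q A g T X (s # ss) r"
      then have ref: "refuted Q T X (add_vertex (mask_of 6 s0) g) r'"
        and ver: "verify Q A g (filter (\<lambda>t. \<forall>p \<in> set A. permute t p \<noteq> mask_of 6 s0) T) X ss r"
        using No_vertex by auto
      have none: "map (E x) hs \<noteq> mask_of 6 s0" if "copy hs g" "x \<in> V - set hs" for hs x
        using not_refuted[OF assms(1,2) copy_snoc[OF that]] ref len[OF that(1)] Cons.prems[OF that(1)]
        by auto
      have "obeys (filter (\<lambda>t. \<forall>p \<in> set A. permute t p \<noteq> mask_of 6 s0) T) X hs" if "copy hs g" for hs
      proof -
        have "permute (map (E x) hs) p \<noteq> mask_of 6 s0" if "x \<in> V - set hs" "p \<in> set A" for x p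
          using none[of "map (\<lambda>i. hs ! i) p" x] automorphism_copy[OF \<open>copy hs g\<close>, of p] assms(3) that by auto
        then show ?thesis using Cons.prems[OF that] by (auto simp: obeys_def)
      qed
      then show False using Cons.IH ver by blast
    qed
  next
    case (No_edge s0 u r')
    let ?X = "map (\<lambda>p. (permute (mask_of 6 s0) p, permute (mask_of 6 u) p)) A @ X"
    show ?thesis
    proof
      assume "verify Q A g T X (s # ss) r"
      then have ref: "refuted Q T X (add_vertex (mask_of 6 u @ [True]) (add_vertex (mask_of 6 s0) g)) r'"
        and invol: "\<And>p. p \<in> set A \<Longrightarrow> permute (permute (mask_of 6 s0) p) p = mask_of 6 s0"
          "\<And>p. p \<in> set A \<Longrightarrow> permute (permute (mask_of 6 u) p) p = mask_of 6 u"
        and ver: "verify Q A g T ?X ss r"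
        using No_edge by auto
      have none: "\<not> (map (E x) hs = mask_of 6 s0 \<and> map (E y) hs = mask_of 6 u)"
        if "copy hs g" "x \<in> V - set hs" "y \<in> V - set hs" "E x y" for hs x y
      proof
        assume types: "map (E x) hs = mask_of 6 s0 \<and> map (E y) hs = mask_of 6 u"
        have "y \<noteq> x" "E y x" using that(4) sym irrefl by blast+
        then have "copy ((hs @ [x]) @ [y]) (add_vertex (mask_of 6 u @ [True]) (add_vertex (mask_of 6 s0) g))"
          using types that by (intro copy_snoc) auto
        from not_refuted[OF assms(1,2) this] show False
          using ref len[OF that(1)] Cons.prems[OF that(1)] by auto
      qed
      have "obeys T ?X hs" if "copy hs g" for hs
      proof -
        \<comment> \<open>Seen from the relabelled copy these neighbourhoods become the refuted
          pair, because \<open>p\<close> acts as an involution on both masks.\<close>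
        have "\<not> (map (E x) hs = permute (mask_of 6 s0) p \<and> map (E y) hs = permute (mask_of 6 u) p)"
          if "x \<in> V - set hs" "y \<in> V - set hs" "E x y" "p \<in> set A" for x y p
          using none[of "map (\<lambda>i. hs ! i) p" x y] automorphism_copy[OF \<open>copy hs g\<close>, of p] assms(3)
            invol[OF that(4)] that by auto
        then show ?thesis using Cons.prems[OF that] by (auto simp: obeys_def)
      qed
      then show False using Cons.IH ver by blast
    qed
  qed
qed

lemma not_verified:
  assumes "\<not> colourable V E 7" and "\<And>q vs. q \<in> set Q \<Longrightarrow> \<not> copy vs q"
    and "verified Q A g ss r"
  shows "\<not> copy hs g"
proof
  assume "copy hs g"
  have "obeys (filter (\<lambda>t. \<not> impossible g t) (List.n_lists 6 [False, True])) [] hs" if "copy hs g" for hs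
    using that assms(3) not_impossible by (auto simp: obeys_def verified_def copy_def set_n_lists)
  from not_verify[OF assms(1,2) _ _ this \<open>copy hs g\<close>] assms(3) show False
    by (auto simp: verified_def list_all_iff)
qed

lemma copy_of_contains_induced:
  assumes "contains_induced V E hex_V F"
  obtains hs where "copy hs (template 6 F)"
proof -
  obtain f where f: "inj_on f {0..<6}" "f ` {0..<6} \<subseteq> V"
      "\<And>i j. i < 6 \<Longrightarrow> j < 6 \<Longrightarrow> E (f i) (f j) \<longleftrightarrow> F i j"
    using assms by (auto simp: contains_induced_def hex_V_def)
  have "view (map f [0..<6]) = template 6 F"
    using f(1,3) by (auto simp: view_def template_def inj_on_def)
  then have "copy (map f [0..<6]) (template 6 F)"
    using f(1,2) by (auto simp: copy_def distinct_map)
  then show ?thesis by (rule that)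
qed

end

section \<open>The co-A and the co-domino\<close>

text \<open>The exclusions and colourings were found with a SAT solver.\<close>

definition coA_steps :: "step list" where
  "coA_steps =
  [No_edge [0,2,5] [2,4,5] (Colouring
    [([0,7],[[1,3,5,6],[2,3,5,6],[3,4,5,6],[1,3,4,5,6],[2,3,4,5,6]]),
     ([1,5],[[0,2,4]]),
     ([3],[[1,5,7],[1,5,6],[1,2,5,7],[1,2,5,6],[1,4,5,6],[1,2,4,5,6]]),
     ([4,6],[[0,1,5,7],[0,1,2,5,7],[1,3,5,7],[0,2,3,5,7]]),
     ([],[[],[3,6,7],[2,4],[2,3,5,7]]),
     ([],[[0,3,6,7],[1,4,6,7],[0,1,4,6,7],[1,3,4,6,7]]),
     ([2],[[0],[1,3,4],[1,3,4,7],[1,3,4,6],[1,3,4,5]])]),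
   No_edge [0,3] [2,3,4] (Colouring
    [([0],[[],[3],[1,3,4],[1,3,5,7],[1,2,4,5,7],[2,3,4,5]]),
     ([1,4,6],[[0,3,7],[0,2,3,5]]),
     ([3,5],[[0,1,4,7],[0,1,4,6,7],[0,2,4],[0,2,4,7],[0,2,4,6],[0,2,4,6,7],[0,1,2,4],[0,1,2,4,7],[0,1,2,4,6],[0,1,2,4,6,7]]),
     ([],[[0,1,2,7],[1,2,4,6,7],[1,2,5,6],[1,2,5,6,7],[0,1,2,5,7],[0,1,2,5,6],[0,1,2,5,6,7],[1,2,4,5,6],[1,2,4,5,6,7]]),
     ([],[[0,7],[0,6,7],[2,5,6,7],[0,2,5,6,7],[1,4,5,6,7],[2,4,5,6,7]]),
     ([2],[[6],[1,4],[1,4,6],[1,5,6,7],[0,1,5,6],[0,1,5,6,7]]),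
     ([7],[[3,6],[1,3,4,6],[2,3,5,6],[2,3,4,5,6]])]),
   No_vertex [2,5] (Colouring
    [([0],[[],[2,4],[2,3,4,6],[2,4,5,6],[1,2,4,5,6],[3,4,5,6],[2,3,4,5,6]]),
     ([1,6],[[2,3,4,5]]),
     ([3],[[1,2,6],[0,1,2,6],[1,2,4,6],[0,1,2,4,6],[1,2,5,6],[0,1,2,5],[0,1,2,5,6],[1,2,4,5]]),
     ([4],[[0,3,6],[0,1,5,6],[0,2,3,5],[0,2,3,5,6]]),
     ([],[[1,4,6],[1,5],[4,5,6],[1,4,5,6]]),
     ([5],[[0,1,4,6],[0,2,4]]),
     ([2],[[1,3,4,6],[1,3,5],[1,3,4,5,6]])]),
   No_vertex [3,4,5] (Colouring
    [([0],[[1,4,5],[1,2,4,5],[1,3,4,5]]),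
     ([1],[[2,3,5,6],[2,4,5],[2,3,4,5]]),
     ([3,5],[[1,4,6],[0,1,4,6],[2,4,6],[0,2,4,6],[1,2,4,6],[0,1,2,4,6]]),
     ([],[[1,5,6],[0,1,5,6],[0,2,5,6],[1,2,5,6],[0,1,2,5,6],[1,3,5,6],[0,2,3,5,6]]),
     ([6],[[],[0]]),
     ([2,4],[[3]]),
     ([],[[1,2,6],[0,1,2],[0,1,2,6],[0,3],[0,1,2,4],[0,1,2,5]])]),
   No_edge [1,4] [0,1,4] (Colouring
    [([0],[[3,7],[3,6],[3,6,7],[1,2,5,6],[2,3,5,6],[2,3,5,6,7]]),
     ([1],[[0,6,7],[0,3,7],[0,3,6,7],[0,2,5,6,7],[0,2,3,5,7],[0,2,3,5,6,7]]),
     ([3,5],[[0,1,4],[0,2,4,6],[0,1,2,4,6]]),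
     ([6],[[2,4,7],[1,2,4,7],[2,3,4,7],[1,2,4,5,7],[1,3,4,5,7],[2,3,4,5,7]]),
     ([4],[[],[0],[0,3,6],[0,1,5],[0,1,2,5,6],[0,2,3,5,6]]),
     ([2],[[1,3,4,7],[1,3,4,6],[1,3,5,7],[1,3,5,6],[1,3,4,5,6]]),
     ([7],[[1,4],[1,5],[1,4,5],[1,2,4,5,6],[2,3,4,5,6]])]),
   No_edge [0] [0,3] (Colouring
    [([0],[[1,4,5,7],[2,4,5,7],[1,2,4,5,7],[1,2,4,5,6],[1,2,4,5,6,7],[1,3,4,5,7],[1,3,4,5,6],[1,3,4,5,6,7],[2,3,4,5,7],[2,3,4,5,6],[2,3,4,5,6,7]]),
     ([1,4],[[3,6,7],[0,3]]),
     ([3,6],[[0,1,4,7],[0,2,4,7],[0,1,2,4,7],[0,1,5,7],[0,2,5,7],[0,1,2,5,7]]),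
     ([],[[1,3,4,6,7],[1,2,5,6,7],[1,3,5,7],[1,3,5,6],[1,3,5,6,7],[2,3,5,6,7]]),
     ([5],[[],[3],[1,4,7],[1,4,6],[2,4,6,7],[1,2,4,6,7],[1,3,4,7],[1,3,4,6],[2,3,4,6,7]]),
     ([7],[[0,1,4,6],[0,2,4,6],[0,1,2,4,6],[0,1,2,5,6],[0,2,3,5,6]]),
     ([2],[[0],[1,4,6,7],[1,5,7]])])]"

definition coA_colouring :: reason where
  "coA_colouring = Colouring
    [([0,2],[[1,3,4],[1,3,5],[1,3,4,5]]),
     ([1],[[2,3,4],[2,3,5],[0,2,3,5],[2,3,4,5]]),
     ([3],[[1,4],[0,1,4],[1,5],[4,5],[1,4,5]]),
     ([],[[0,2,4],[0,2,5],[2,4,5]]),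
     ([],[[1,2,4],[0,1,2,4],[1,2,5],[0,1,2,5],[1,2,4,5]]),
     ([5],[[],[1,2],[3],[2,4]]),
     ([4],[[0],[0,3],[0,1,5]])]"

text \<open>\<open>[3,4,5,0,1,2]\<close> is the half-turn of the 6-cycle, the only nontrivial
  automorphism of the co-A. No template is excluded beforehand, so every step rests on a
  colouring.\<close>

lemma coA_verified:
  "verified [] [[0,1,2,3,4,5], [3,4,5,0,1,2]]
     (template 6 coA_E) coA_steps coA_colouring"
  by code_simp

text \<open>An \<open>Occurrence\<close> lists vertices in the roles u1, v1, v2, v3, u3, u2 of a
  co-A; in the first step the new vertex 6 replaces v3. The last two steps rest on
  colourings.\<close>

definition codomino_steps :: "step list" where
  "codomino_steps =
  [No_vertex [0,1,2,4] (Occurrence [0,1,2,6,4,5]),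
   No_vertex [0,1,2,5] (Occurrence [0,1,2,6,5,4]),
   No_edge [0,1,5] [1,3,5] (Occurrence [1,6,5,7,3,2]),
   No_edge [0,1,3,4] [2,4,5] (Occurrence [4,3,1,6,7,5]),
   No_edge [0,2,5] [2,3,5] (Occurrence [2,6,5,7,3,1]),
   No_edge [2,3,4] [1,2,4,5] (Occurrence [4,6,2,7,5,0]),
   No_edge [0,2,3,5] [1,2,4,5] (Colouring
    [([0,7],[[1,2,5,6],[2,4,5],[2,4,5,6],[1,2,4,5],[1,2,4,5,6],[3,4,5,6]]),
     ([4],[[],[0,1,5,7],[2,5],[2,5,7],[1,2,5],[1,3,5],[1,3,5,7],[1,3,5,6],[2,3,5,7]]),
     ([2,5],[[6,7],[0,3,6,7],[1,4,6,7],[0,1,3,4,6,7]]),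
     ([6],[[7],[0,3,7],[1,4,7],[0,1,3,4,7]]),
     ([3],[[0,1,2,6],[0,2,4],[0,2,4,7],[0,2,4,6],[2,5,6],[0,2,5]]),
     ([],[[6],[0,3],[0,3,6],[1,4],[1,4,6],[0,1,3,4],[0,1,3,4,6]]),
     ([1],[[2,3,4,7],[0,2,5,7],[2,3,5],[0,2,3,5],[0,2,3,5,7]])]),
   No_edge [1,4] [1,2,4,5] (Colouring
    [([0],[[],[1,2,5,6],[1,3,5],[1,3,5,7],[1,3,5,6],[2,3,5,6]]),
     ([1,4],[[6,7],[0,3,6,7],[2,5,6,7],[0,2,5,6,7],[2,3,5,6,7],[0,2,3,5,6,7]]),
     ([5,6],[[1,4,7],[0,2,4,7],[0,1,3,4,7],[2,3,4,7]]),
     ([],[[0,1,2,6],[0,1,5,7],[0,2,3,5,6],[1,2,4,5],[1,2,4,5,6]]),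
     ([2],[[0,3,6],[1,4],[1,4,6],[0,1,3,4,6]]),
     ([3,7],[[6],[0,2,4],[0,2,4,6],[2,5,6],[0,2,5,6],[2,4,5,6]]),
     ([],[[7],[0,3,7],[0,2,3,5,7],[3,4,5,6]])])]"

text \<open>\<open>[0,3]\<close> and \<open>[1,4]\<close> each appear in two classes: they miss the
  edges 12 and 23 respectively, so their vertices induce matchings.\<close>

definition codomino_colouring :: reason where
  "codomino_colouring = Colouring
    [([0,3],[[],[2,5],[1,2,5],[2,4,5]]),
     ([4],[[0,1,2],[0,3],[0,2,3,5]]),
     ([5],[[1,4],[2,3,4]]),
     ([1],[[0,2,4],[0,2,5]]),
     ([],[[1,4],[0,1,5],[1,2,4,5]]),
     ([2],[[0,3],[3,4,5]]),
     ([],[[0,1,3,4],[1,3,5],[2,3,5]])]"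

text \<open>The automorphisms form a Klein four-group: \<open>[1,0,5,4,3,2]\<close> swaps the
  triangles 123 and 045, \<open>[4,3,2,1,0,5]\<close> reflects each of them, and
  \<open>[3,4,5,0,1,2]\<close> is the product.\<close>

lemma codomino_verified:
  "verified [template 6 coA_E] [[0,1,2,3,4,5], [1,0,5,4,3,2], [3,4,5,0,1,2], [4,3,2,1,0,5]]
     (template 6 codomino_E) codomino_steps codomino_colouring"
  by code_simp

theorem theorem1p2:
  fixes V :: "'a set" and E :: "'a \<Rightarrow> 'a \<Rightarrow> bool"
  assumes "simple_graph V E"
    and "free_of V E P3_P2_V P3_P2_E"
    and "free_of V E K4_V K4_E"
    and "contains_induced V E hex_V codomino_E \<or> contains_induced V E hex_V coA_E"
  shows "chromatic_number V E \<le> 7"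
proof -
  interpret P3_P2_K4_free V E
    using assms(1-3) by unfold_locales
  have "colourable V E 7"
  proof (rule ccontr)
    assume not_colourable: "\<not> colourable V E 7"
    have no_coA: "\<not> copy hs (template 6 coA_E)" for hs
      using not_verified[OF not_colourable _ coA_verified] by simp
    \<comment> \<open>The absence of co-A copies justifies the template excluded in advance.\<close>
    then have "\<not> copy hs (template 6 codomino_E)" for hs
      using not_verified[OF not_colourable _ codomino_verified] by simp
    with no_coA show False
      using assms(4) copy_of_contains_induced by metis
  qed
  then show ?thesis
    unfolding chromatic_number_def by (rule Least_le)
qed

end
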